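(* None of the following three classes of real square matrices contains all tridiagonal P-matrices: (1) the Z-matrices; (2) the hidden Z-matrices; (3) the transposes of hidden K-matrices. That is, for each of these three classes there exist a positive integer $n$ and a tridiagonal P-matrix in $\mathbb{R}^{n\times n}$ that does not belong to the class.
   Context: A matrix $M=(m_{ij})\in\mathbb{R}^{n\times n}$ is tridiagonal if $m_{ij}=0$ whenever $|j-i|>1$. It is a P-matrix if all its principal minors (determinants of principal submatrices) are positive. It is a Z-matrix if all its off-diagonal entries are nonpositive. It is a hidden Z-matrix if there exist Z-matrices $X,Y\in\mathbb{R}^{n\times n}$ and nonnegative vectors $r,s\in\mathbb{R}^n$ such that $MX=Y$ and $r^TX+s^TY>0$ (all components strictly positive). It is a hidden K-matrix if it is both a hidden Z-matrix and a P-matrix. A matrix is the transpose of a hidden K-matrix if its transpose $M^T$ is a hidden K-matrix. *)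

theory Defs
  imports
    Complex_Main
    "Jordan_Normal_Form.Determinant"
    "Jordan_Normal_Form.DL_Submatrix"
begin

(* Rows and columns of a matrix are indexed from 0. *)

definition tridiagonal :: "real mat \<Rightarrow> bool" where
  "tridiagonal M \<longleftrightarrow> square_mat M \<and>
     (\<forall>i < dim_row M. \<forall>j < dim_row M. \<bar>int j - int i\<bar> > 1 \<longrightarrow> M $$ (i, j) = 0)"

definition P_matrix :: "real mat \<Rightarrow> bool" where
  "P_matrix M \<longleftrightarrow> square_mat M \<and>
     (\<forall>I. I \<noteq> {} \<and> I \<subseteq> {0..<dim_row M} \<longrightarrow> det (submatrix M I I) > 0)"

definition Z_matrix :: "real mat \<Rightarrow> bool" where
  "Z_matrix M \<longleftrightarrow> square_mat M \<and>
     (\<forall>i < dim_row M. \<forall>j < dim_row M. i \<noteq> j \<longrightarrow> M $$ (i, j) \<le> 0)"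

(* The order on vectors is componentwise between vectors of equal dimension, so
   0\<^sub>v n \<le> r also says that r has dimension n.  The row vector r^T X is written as the
   column vector X^T r.  The strict order < of the library only means \<le> and not \<ge>,
   hence strict positivity of all components is spelled out. *)
definition hidden_Z_matrix :: "real mat \<Rightarrow> bool" where
  "hidden_Z_matrix M \<longleftrightarrow> square_mat M \<and>
     (let n = dim_row M in
      \<exists>X \<in> carrier_mat n n. \<exists>Y \<in> carrier_mat n n. \<exists>r \<in> carrier_vec n. \<exists>s \<in> carrier_vec n.
        Z_matrix X \<and> Z_matrix Y \<and> 0\<^sub>v n \<le> r \<and> 0\<^sub>v n \<le> s \<and> M * X = Y \<and>
        (\<forall>j < n. (transpose_mat X *\<^sub>v r + transpose_mat Y *\<^sub>v s) $ j > 0))"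

definition hidden_K_matrix :: "real mat \<Rightarrow> bool" where
  "hidden_K_matrix M \<longleftrightarrow> hidden_Z_matrix M \<and> P_matrix M"

definition transpose_hidden_K_matrix :: "real mat \<Rightarrow> bool" where
  "transpose_hidden_K_matrix M \<longleftrightarrow> hidden_K_matrix (transpose_mat M)"

end

(* One 4 x 4 matrix M, together with its transpose, settles all three classes.
   P-property: if m_{i,i+1} m_{i+1,i} <= 0, all terms in the three-term recursion for the
   determinant have the right sign, and both hypotheses pass to principal submatrices.
   Hidden Z: put p = r + M^T s, an element of the cone K generated by the unit vectors e_i and
   the rows m_i of M.  If x is column j of X and p lies in the subcone K_j generated by the e_i
   and m_i with i different from j, then p.x <= 0 because X and MX are Z-matrices.  Hence M is not
   hidden Z as soon as the subcones K_j cover K, and for the chosen M they do. *)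
theory Submission
  imports Defs
begin

section \<open>Determinants of tridiagonal matrices and the P-property\<close>

text \<open>Laplace expansion along row 0 leaves two cofactors. The second one is a minor whose
  first column has the single possibly nonzero entry \<open>f 1 0\<close>, so it is expanded along
  that column.\<close>

lemma det_tridiagonal_Suc_Suc:
  fixes f :: "nat \<Rightarrow> nat \<Rightarrow> 'a :: comm_ring_1"
  assumes row: "\<And>j. 1 < j \<Longrightarrow> j < Suc (Suc n) \<Longrightarrow> f 0 j = 0"
    and col: "\<And>i. 1 < i \<Longrightarrow> i < Suc (Suc n) \<Longrightarrow> f i 0 = 0"
  shows "det (mat (Suc (Suc n)) (Suc (Suc n)) (\<lambda>(i, j). f i j)) =
    f 0 0 * det (mat (Suc n) (Suc n) (\<lambda>(i, j). f (Suc i) (Suc j))) -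
    f 0 1 * f 1 0 * det (mat n n (\<lambda>(i, j). f (Suc (Suc i)) (Suc (Suc j))))"
proof -
  let ?A = "mat (Suc (Suc n)) (Suc (Suc n)) (\<lambda>(i, j). f i j)"
  let ?B = "mat_delete ?A 0 (Suc 0)"
  have B: "?B \<in> carrier_mat (Suc n) (Suc n)"
    by (simp add: mat_delete_def)
  have B0: "?B $$ (i, 0) = f (Suc i) 0" if "i < Suc n" for i
    using that by (simp add: mat_delete_def)
  have BB: "mat_delete ?B 0 0 = mat n n (\<lambda>(i, j). f (Suc (Suc i)) (Suc (Suc j)))"
    by (rule eq_matI) (auto simp: mat_delete_def)
  have "det ?B = (\<Sum>i<Suc n. ?B $$ (i, 0) * cofactor ?B i 0)"
    by (rule laplace_expansion_column[OF B]) simp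
  also have "\<dots> = ?B $$ (0, 0) * cofactor ?B 0 0"
    unfolding sum.lessThan_Suc_shift using B0 col by simp
  finally have detB: "det ?B = f (Suc 0) 0 * det (mat n n (\<lambda>(i, j). f (Suc (Suc i)) (Suc (Suc j))))"
    by (simp add: B0 cofactor_def BB)
  have AA: "mat_delete ?A 0 0 = mat (Suc n) (Suc n) (\<lambda>(i, j). f (Suc i) (Suc j))"
    by (rule eq_matI) (auto simp: mat_delete_def)
  have "det ?A = (\<Sum>j<Suc (Suc n). ?A $$ (0, j) * cofactor ?A 0 j)"
    by (rule laplace_expansion_row) auto
  also have "\<dots> = f 0 0 * cofactor ?A 0 0 + f 0 1 * cofactor ?A 0 1"
    unfolding sum.lessThan_Suc_shift by (simp add: row del: sum.lessThan_Suc)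
  finally show ?thesis
    by (simp add: cofactor_def AA detB algebra_simps)
qed

lemma det_tridiagonal_pos:
  fixes f :: "nat \<Rightarrow> nat \<Rightarrow> 'a :: linordered_idom"
  assumes "\<And>i. i < n \<Longrightarrow> f i i > 0"
    and "\<And>i. Suc i < n \<Longrightarrow> f i (Suc i) * f (Suc i) i \<le> 0"
    and "\<And>i j. j < n \<Longrightarrow> Suc i < j \<Longrightarrow> f i j = 0 \<and> f j i = 0"
  shows "det (mat n n (\<lambda>(i, j). f i j)) > 0"
  using assms
proof (induction n arbitrary: f rule: less_induct)
  case (less n)
  note diag = less.prems(1) and off = less.prems(2) and tri = less.prems(3)
  \<comment> \<open>The recursion reaches back two sizes, hence two base cases; the empty
    determinant is 1.\<close>
  consider "n = 0" | "n = 1" | k where "n = Suc (Suc k)"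
    by (metis One_nat_def not0_implies_Suc)
  then show ?case
  proof cases
    case 1
    then show ?thesis by simp
  next
    case 2
    then show ?thesis using diag[of 0] by (simp add: det_single)
  next
    case 3
    define D1 where "D1 = det (mat (Suc k) (Suc k) (\<lambda>(i, j). f (Suc i) (Suc j)))"
    define D2 where "D2 = det (mat k k (\<lambda>(i, j). f (Suc (Suc i)) (Suc (Suc j))))"
    have "D1 > 0"
      unfolding D1_def using diag off tri by (intro less.IH) (auto simp: 3)
    moreover have "D2 > 0"
      unfolding D2_def using diag off tri by (intro less.IH) (auto simp: 3)
    moreover have "f 0 0 > 0" "f 0 1 * f 1 0 \<le> 0"
      using diag[of 0] off[of 0] by (auto simp: 3)
    ultimately have "0 < f 0 0 * D1" "f 0 1 * f 1 0 * D2 \<le> 0"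
      by (simp_all add: mult_nonpos_nonneg)
    moreover have "det (mat n n (\<lambda>(i, j). f i j)) = f 0 0 * D1 - f 0 1 * f 1 0 * D2"
      unfolding 3 D1_def D2_def using tri
      by (intro det_tridiagonal_Suc_Suc) (auto simp: 3)
    ultimately show ?thesis by linarith
  qed
qed

lemma tridiagonal_imp_P_matrix:
  assumes tri: "tridiagonal M"
    and diag: "\<And>i. i < dim_row M \<Longrightarrow> M $$ (i, i) > 0"
    and off: "\<And>i. Suc i < dim_row M \<Longrightarrow> M $$ (i, Suc i) * M $$ (Suc i, i) \<le> 0"
  shows "P_matrix M"
  unfolding P_matrix_def
proof (intro conjI allI impI)
  show sq: "square_mat M"
    using tri by (simp add: tridiagonal_def)
  fix I assume "I \<noteq> {} \<and> I \<subseteq> {0..<dim_row M}"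
  then have I: "I \<subseteq> {0..<dim_row M}" by simp
  \<comment> \<open>\<open>submatrix\<close> takes its dimensions from the cardinality of this
    set.\<close>
  then have card: "{i. i < dim_row M \<and> i \<in> I} = I" by auto
  have pick: "pick I i < dim_row M" if "i < card I" for i
    using pick_in_set_le[OF that] I by auto
  have mono: "pick I i < pick I j" if "i < j" "j < card I" for i j
    using pick_mono_le[OF that(2,1)] .
  have far: "M $$ (a, b) = 0 \<and> M $$ (b, a) = 0" if "Suc a < b" "b < dim_row M" for a b
    using tri that by (auto simp: tridiagonal_def)
  have "det (mat (card I) (card I) (\<lambda>(i, j). M $$ (pick I i, pick I j))) > 0"
  proof (rule det_tridiagonal_pos)
    show "M $$ (pick I i, pick I i) > 0" if "i < card I" for i
      using diag pick that by blast
    show "M $$ (pick I i, pick I (Suc i)) * M $$ (pick I (Suc i), pick I i) \<le> 0"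
      if "Suc i < card I" for i
    \<comment> \<open>Neighbours in \<open>I\<close> are either neighbours in \<open>M\<close>,
      where \<open>off\<close> applies, or separated by a gap, where both entries of
      \<open>M\<close> vanish.\<close>
    proof (cases "pick I (Suc i) = Suc (pick I i)")
      case True
      then show ?thesis using off[of "pick I i"] pick[OF that] by simp
    next
      case False
      then have "Suc (pick I i) < pick I (Suc i)"
        using mono[of i "Suc i"] that by linarith
      then show ?thesis using far[OF _ pick[OF that]] by simp
    qed
    show "M $$ (pick I i, pick I j) = 0 \<and> M $$ (pick I j, pick I i) = 0"
      if "j < card I" "Suc i < j" for i j
    proof (rule far[OF _ pick[OF that(1)]])
      show "Suc (pick I i) < pick I j"
        using mono[of i "Suc i"] mono[of "Suc i" j] that by linarith
    qed
  qed
  then show "det (submatrix M I I) > 0"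
    using sq card by (simp add: submatrix_def)
qed

section \<open>The 4 x 4 counterexample\<close>

text \<open>Opposite off-diagonal entries have opposite signs, which gives the P-property; the
  magnitudes are such that the subcones cover the cone.\<close>

definition tridiag4 :: "real mat" where
  "tridiag4 = mat_of_rows_list 4 [[1, -1, 0, 0], [2, 1, -2, 0], [0, 2, 1, 2], [0, 0, -1, 1]]"

lemma tridiag4_carrier: "tridiag4 \<in> carrier_mat 4 4"
  by (rule carrier_matI) (simp_all add: tridiag4_def mat_of_rows_list_def)

lemma less_4_cases:
  assumes "i < (4 :: nat)"
  obtains "i = 0" | "i = 1" | "i = 2" | "i = 3"
  using assms by linarith

lemma tridiag4_tridiagonal: "tridiagonal tridiag4"
  unfolding tridiagonal_def
proof (intro conjI allI impI)
  show "square_mat tridiag4" using tridiag4_carrier by simp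
  fix i j assume ij: "i < dim_row tridiag4" "j < dim_row tridiag4" "1 < \<bar>int j - int i\<bar>"
  then have "i < 4" "j < 4" using tridiag4_carrier by auto
  then show "tridiag4 $$ (i, j) = 0"
    using ij(3) by (auto elim!: less_4_cases simp: tridiag4_def mat_of_rows_list_def)
qed

lemma tridiag4_diag:
  assumes "i < 4"
  shows "tridiag4 $$ (i, i) > 0"
  using assms by (auto elim!: less_4_cases simp: tridiag4_def mat_of_rows_list_def)

lemma tridiag4_off_diag:
  assumes "Suc i < 4"
  shows "tridiag4 $$ (i, Suc i) * tridiag4 $$ (Suc i, i) \<le> 0"
proof -
  consider "i = 0" | "i = 1" | "i = 2" using assms by linarith
  then show ?thesis
    by cases (auto simp: tridiag4_def mat_of_rows_list_def)
qed

lemma tridiag4_P_matrix: "P_matrix tridiag4"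
  by (rule tridiagonal_imp_P_matrix[OF tridiag4_tridiagonal])
    (use tridiag4_carrier tridiag4_diag tridiag4_off_diag in auto)

section \<open>The covering argument against hidden Z\<close>

text \<open>Entrywise form of the obstruction: \<open>x\<close> and \<open>y\<close> stand for X and
  Y = MX, the four equations for \<open>y\<close> are the rows of M, and the sums form component j
  of r^T X + s^T Y.\<close>

lemma tridiag4_obstruction:
  fixes r s :: "nat \<Rightarrow> real" and x y :: "nat \<Rightarrow> nat \<Rightarrow> real"
  assumes nonneg: "\<And>i. i < 4 \<Longrightarrow> 0 \<le> r i \<and> 0 \<le> s i"
    and nonpos: "\<And>i j. i < 4 \<Longrightarrow> j < 4 \<Longrightarrow> i \<noteq> j \<Longrightarrow> x i j \<le> 0 \<and> y i j \<le> 0"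
    and y: "\<And>j. j < 4 \<Longrightarrow> y 0 j = x 0 j - x 1 j"
      "\<And>j. j < 4 \<Longrightarrow> y 1 j = 2 * x 0 j + x 1 j - 2 * x 2 j"
      "\<And>j. j < 4 \<Longrightarrow> y 2 j = 2 * x 1 j + x 2 j + 2 * x 3 j"
      "\<And>j. j < 4 \<Longrightarrow> y 3 j = x 3 j - x 2 j"
  shows "\<exists>j<4. (\<Sum>i<4. x i j * r i) + (\<Sum>i<4. y i j * s i) \<le> 0"
proof -
  \<comment> \<open>The coordinates of p = r + M^T s, read off the columns of M.\<close>
  define p0 where "p0 = r 0 + s 0 + 2 * s 1"
  define p1 where "p1 = r 1 - s 0 + s 1 + 2 * s 2"
  define p2 where "p2 = r 2 - 2 * s 1 + s 2 - s 3"
  define p3 where "p3 = r 3 + 2 * s 2 + s 3"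
  note p = p0_def p1_def p2_def p3_def
  have sum4: "(\<Sum>i<4. g i) = g 0 + g 1 + g 2 + g 3" for g :: "nat \<Rightarrow> real"
    by (simp add: eval_nat_numeral)
  have q: "(\<Sum>i<4. x i j * r i) + (\<Sum>i<4. y i j * s i) =
      p0 * x 0 j + p1 * x 1 j + p2 * x 2 j + p3 * x 3 j" if "j < 4" for j
    unfolding sum4 y[OF that] p by (simp add: algebra_simps)
  have rs: "0 \<le> r 0" "0 \<le> r 1" "0 \<le> r 2" "0 \<le> r 3"
    "0 \<le> s 0" "0 \<le> s 1" "0 \<le> s 2" "0 \<le> s 3"
    using nonneg by auto
  \<comment> \<open>the facet inequalities of the cone \<open>K\<close>, which contains \<open>p\<close>\<close>
  have facets: "0 \<le> p0" "0 \<le> p3" "0 \<le> p0 + p1" "0 \<le> p0 + p2 + p3"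
    "0 \<le> 2 * p0 + 2 * p1 + 3 * p2 + 3 * p3"
    using rs by (simp_all add: p)
  have sumnp: "a * u + b * v + c * w + d * z \<le> 0"
    if "0 \<le> a" "0 \<le> b" "0 \<le> c" "0 \<le> d" "u \<le> 0" "v \<le> 0" "w \<le> 0" "z \<le> 0"
    for a b c d u v w z :: real
    using that by (simp add: add_nonpos_nonpos mult_nonneg_nonpos)
  have np: "x i j \<le> 0" "y i j \<le> 0" if "i < 4" "j < 4" "i \<noteq> j" for i j
    using nonpos that by auto
  \<comment> \<open>Each case places \<open>p\<close> in the simplicial cone named by its four generators; these avoid an
    index \<open>j\<close>, and the coefficients used below are the coordinates of \<open>p\<close> in these generators.\<close>
  consider (e1_e2_m1_m3) "p0 \<le> 2 * p1"
    | (e1_m0_m1_m3) "p2 + p3 \<le> 0"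
    | (e1_e3_m0_m3) "p2 \<le> 0" "0 \<le> p2 + p3"
    | (e2_m0_m1_m2) "0 \<le> p2" "2 * p1 \<le> p0" "p3 \<le> p0 + p1" "7 * p3 \<le> 6 * p2 + 4 * (p0 + p1)"
    | (e2_m0_m2_m3) "p0 + p1 \<le> p3" "3 * (p0 + p1) \<le> 2 * (p2 + p3)"
    | (e0_m0_m2_m3) "0 \<le> p2 + p3" "2 * p2 \<le> p3" "3 * p1 \<le> 2 * (p2 + p3)"
        "2 * (p2 + p3) \<le> 3 * (p0 + p1)"
    \<comment> \<open>The first three cases leave 2 * p1 < p0 and p2 > 0. If then p3 \<le> p0 + p1,
      either \<open>e2_m0_m1_m2\<close> applies or its last inequality fails, which forces
      \<open>e0_m0_m2_m3\<close>. If p3 > p0 + p1, the second inequality of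
      \<open>e2_m0_m2_m3\<close> decides between that case and \<open>e0_m0_m2_m3\<close>.\<close>
    using facets by argo
  then show ?thesis
  proof cases
    case e1_e2_m1_m3
    have "(p1 - p0 / 2) * x 1 0 + (p0 + p2 + p3) * x 2 0 + (p0 / 2) * y 1 0 + p3 * y 3 0 \<le> 0"
      by (rule sumnp) (use e1_e2_m1_m3 facets np in auto)
    \<comment> \<open>Expanding \<open>y\<close> by the rows of M collapses the combination to p.x
      for column 0, which is the required sum by \<open>q\<close>. The other cases do the same with
      their own column.\<close>
    then have "(\<Sum>i<4. x i 0 * r i) + (\<Sum>i<4. y i 0 * s i) \<le> 0"
      by (subst q) (simp_all add: y field_simps del: One_nat_def)
    then show ?thesis by (intro exI[of _ 0]) auto
  next
    case e1_m0_m1_m3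
    have "((2 * p0 + 2 * p1 + 3 * p2 + 3 * p3) / 2) * x 1 2 + (p0 + p2 + p3) * y 0 2 +
        (- (p2 + p3) / 2) * y 1 2 + p3 * y 3 2 \<le> 0"
      by (rule sumnp) (use e1_m0_m1_m3 facets np in auto)
    then have "(\<Sum>i<4. x i 2 * r i) + (\<Sum>i<4. y i 2 * s i) \<le> 0"
      by (subst q) (simp_all add: y field_simps del: One_nat_def)
    then show ?thesis by (intro exI[of _ 2]) auto
  next
    case e1_e3_m0_m3
    have "(p0 + p1) * x 1 2 + (p2 + p3) * x 3 2 + p0 * y 0 2 + (- p2) * y 3 2 \<le> 0"
      by (rule sumnp) (use e1_e3_m0_m3 facets np in auto)
    then have "(\<Sum>i<4. x i 2 * r i) + (\<Sum>i<4. y i 2 * s i) \<le> 0"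
      by (subst q) (simp_all add: y field_simps del: One_nat_def)
    then show ?thesis by (intro exI[of _ 2]) auto
  next
    case e2_m0_m1_m2
    have "((6 * p2 + 4 * (p0 + p1) - 7 * p3) / 6) * x 2 3 + ((p0 - 2 * p1 + 2 * p3) / 3) * y 0 3 +
        ((p0 + p1 - p3) / 3) * y 1 3 + (p3 / 2) * y 2 3 \<le> 0"
      by (rule sumnp) (use e2_m0_m1_m2 facets np in auto)
    then have "(\<Sum>i<4. x i 3 * r i) + (\<Sum>i<4. y i 3 * s i) \<le> 0"
      by (subst q) (simp_all add: y field_simps del: One_nat_def)
    then show ?thesis by (intro exI[of _ 3]) auto
  next
    case e2_m0_m2_m3
    have "((2 * (p2 + p3) - 3 * (p0 + p1)) / 2) * x 2 1 + p0 * y 0 1 +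
        ((p0 + p1) / 2) * y 2 1 + (p3 - (p0 + p1)) * y 3 1 \<le> 0"
      by (rule sumnp) (use e2_m0_m2_m3 facets np in auto)
    then have "(\<Sum>i<4. x i 1 * r i) + (\<Sum>i<4. y i 1 * s i) \<le> 0"
      by (subst q) (simp_all add: y field_simps del: One_nat_def)
    then show ?thesis by (intro exI[of _ 1]) auto
  next
    case e0_m0_m2_m3
    have "((3 * (p0 + p1) - 2 * (p2 + p3)) / 3) * x 0 1 + ((2 * (p2 + p3) - 3 * p1) / 3) * y 0 1 +
        ((p2 + p3) / 3) * y 2 1 + ((p3 - 2 * p2) / 3) * y 3 1 \<le> 0"
      by (rule sumnp) (use e0_m0_m2_m3 facets np in auto)
    then have "(\<Sum>i<4. x i 1 * r i) + (\<Sum>i<4. y i 1 * s i) \<le> 0"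
      by (subst q) (simp_all add: y field_simps del: One_nat_def)
    then show ?thesis by (intro exI[of _ 1]) auto
  qed
qed

lemma tridiag4_not_hidden_Z_matrix: "\<not> hidden_Z_matrix tridiag4"
proof
  have dim: "dim_row tridiag4 = 4" "dim_col tridiag4 = 4"
    using tridiag4_carrier by auto
  assume "hidden_Z_matrix tridiag4"
  then obtain X Y r s where carrier: "X \<in> carrier_mat 4 4" "Y \<in> carrier_mat 4 4"
      "r \<in> carrier_vec 4" "s \<in> carrier_vec 4"
    and Z: "Z_matrix X" "Z_matrix Y" and nonneg: "0\<^sub>v 4 \<le> r" "0\<^sub>v 4 \<le> s"
    and Y: "tridiag4 * X = Y"
    and pos: "\<And>j. j < 4 \<Longrightarrow> (transpose_mat X *\<^sub>v r + transpose_mat Y *\<^sub>v s) $ j > 0"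
    unfolding hidden_Z_matrix_def Let_def dim by blast
  have Yij: "Y $$ (i, j) = (\<Sum>k<4. tridiag4 $$ (i, k) * X $$ (k, j))" if "i < 4" "j < 4" for i j
    unfolding Y[symmetric] using that carrier(1) dim
    by (simp add: scalar_prod_def atLeast0LessThan)
  have "\<exists>j<4. (\<Sum>i<4. X $$ (i, j) * r $ i) + (\<Sum>i<4. Y $$ (i, j) * s $ i) \<le> 0"
  proof (rule tridiag4_obstruction)
    show "0 \<le> r $ i \<and> 0 \<le> s $ i" if "i < 4" for i
      using nonneg that carrier by (auto simp: less_eq_vec_def)
    show "X $$ (i, j) \<le> 0 \<and> Y $$ (i, j) \<le> 0" if "i < 4" "j < 4" "i \<noteq> j" for i j
      using Z carrier that by (auto simp: Z_matrix_def)
  qed (simp_all add: Yij tridiag4_def mat_of_rows_list_def eval_nat_numeral)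
  then obtain j where j: "j < 4"
    and le: "(\<Sum>i<4. X $$ (i, j) * r $ i) + (\<Sum>i<4. Y $$ (i, j) * s $ i) \<le> 0"
    by blast
  \<comment> \<open>The nonpositive sums are exactly a component that the hidden Z condition makes
    positive.\<close>
  have "(transpose_mat X *\<^sub>v r + transpose_mat Y *\<^sub>v s) $ j =
      (\<Sum>i<4. X $$ (i, j) * r $ i) + (\<Sum>i<4. Y $$ (i, j) * s $ i)"
    using j carrier by (simp add: scalar_prod_def atLeast0LessThan)
  with le pos[OF j] show False by simp
qed

section \<open>Transposition and the three classes\<close>

lemma tridiagonal_transpose:
  assumes "tridiagonal M"
  shows "tridiagonal (transpose_mat M)"
  using assms by (auto simp: tridiagonal_def abs_minus_commute)

text \<open>The sign criterion is symmetric: transposing only swaps the two factors of each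
  off-diagonal product.\<close>

lemma tridiag4_transpose_P_matrix: "P_matrix (transpose_mat tridiag4)"
proof (rule tridiagonal_imp_P_matrix)
  show "tridiagonal (transpose_mat tridiag4)"
    by (rule tridiagonal_transpose[OF tridiag4_tridiagonal])
qed (use tridiag4_carrier tridiag4_diag tridiag4_off_diag in \<open>auto simp: mult.commute\<close>)

theorem mainTheorem2:
  shows "(\<exists>n::nat. n \<ge> 1 \<and>
            (\<exists>M \<in> carrier_mat n n. tridiagonal M \<and> P_matrix M \<and> \<not> Z_matrix M)) \<and>
         (\<exists>n::nat. n \<ge> 1 \<and>
            (\<exists>M \<in> carrier_mat n n. tridiagonal M \<and> P_matrix M \<and> \<not> hidden_Z_matrix M)) \<and>
         (\<exists>n::nat. n \<ge> 1 \<and>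
            (\<exists>M \<in> carrier_mat n n. tridiagonal M \<and> P_matrix M \<and> \<not> transpose_hidden_K_matrix M))"
proof (intro conjI exI[of _ 4] bexI)
  \<comment> \<open>A positive off-diagonal entry rules out the Z-property.\<close>
  have "tridiag4 $$ (1, 0) = 2"
    by (simp add: tridiag4_def mat_of_rows_list_def)
  then show "\<not> Z_matrix tridiag4"
    using tridiag4_carrier unfolding Z_matrix_def
    by (metis carrier_matD(1) not_numeral_le_zero one_less_numeral_iff semiring_norm(76) zero_less_numeral zero_neq_one)
  \<comment> \<open>Transposing twice returns \<open>tridiag4\<close>, which would have to be hidden
    K and hence hidden Z.\<close>
  show "\<not> transpose_hidden_K_matrix (transpose_mat tridiag4)"
    using tridiag4_not_hidden_Z_matrix
    by (simp add: transpose_hidden_K_matrix_def hidden_K_matrix_def)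
qed (use tridiag4_carrier tridiag4_tridiagonal tridiag4_P_matrix tridiag4_not_hidden_Z_matrix
    tridiag4_transpose_P_matrix tridiagonal_transpose in auto)

end
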